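(* Let $\phi(t)=\sum_{p\ge 0} g_p t^p$ be the formal power series in which $g_p$ is the number of Gated Ferrers diagrams of half-perimeter $p$ (as defined in the context). Then $\phi$ satisfies the quadratic equation $$\left[t^2 (1- 2 t)^4 (1-3t + t^2)\right] \phi^2 + \left[t^4 (1-3t+t^2) (1-2 t)^2 \right] \phi -t^{10}= 0 .$$
   Context: A Ferrers diagram (in this convention) is a finite collection of rows of unit square cells stacked vertically, numbered $1,\dots,n$ from bottom to top, all rows left-aligned (row $i$ occupies columns $1,\dots,m_i$), with $1\le m_1\le m_2\le\dots\le m_n$. Its half-perimeter is $m_n+n$ (half the length of its boundary). A Gated Ferrers diagram is a Ferrers diagram from which another Ferrers diagram (same conventions) is removed from the top, i.e. with an opening at the top. Precisely, it is given by integers $1\le j<n$, an integer $\ell\ge 1$, and integers $m_1,\dots,m_n$ and $g_{j+1},\dots,g_n$ such that: rows $1,\dots,j$ are full rows occupying columns $1,\dots,m_i$ with $m_1\le\dots\le m_j$; for $j<i\le n$, row $i$ occupies columns $1,\dots,\ell$ and columns $g_i+1,\dots,m_i$, the columns $\ell+1,\dots,g_i$ being empty (the gate), where $\ell<g_i<m_i$; and moreover $g_{j+1}<m_j$, and for $j<i<n$: $g_i\le g_{i+1}<m_i$; and $m_j\le m_{j+1}\le\dots\le m_n$. (Thus the removed cells form a left-aligned Ferrers shape whose bottom row lies directly above cells of row $j$ and whose top is open.) Its half-perimeter is half the length of the boundary of the union of its cells, which equals $m_n+n+(n-j)$. *)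

theory Defs
  imports "HOL-Computational_Algebra.Formal_Power_Series"
begin

text \<open>
  A unit cell is the pair (column, row) of its integer coordinates. Rows are numbered from
  bottom to top.
\<close>

type_synonym cell = "int \<times> int"

definition neighbours :: "cell \<Rightarrow> cell set" where
  "neighbours = (\<lambda>(c, r). {(c + 1, r), (c - 1, r), (c, r + 1), (c, r - 1)})"

text \<open>
  A unit segment lies on the boundary of the union of the cells of \<open>S\<close> iff it separates a cell
  of \<open>S\<close> from an adjacent cell outside \<open>S\<close>, and then it determines this pair of cells.
\<close>

definition boundary_edges :: "cell set \<Rightarrow> (cell \<times> cell) set" where
  "boundary_edges S = {(x, y). x \<in> S \<and> y \<in> neighbours x \<and> y \<notin> S}"

definition half_perimeter :: "cell set \<Rightarrow> real" where
  "half_perimeter S = real (card (boundary_edges S)) / 2"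

definition gated_ferrers_data ::
    "nat \<Rightarrow> nat \<Rightarrow> int \<Rightarrow> (nat \<Rightarrow> int) \<Rightarrow> (nat \<Rightarrow> int) \<Rightarrow> bool" where
  "gated_ferrers_data n j l m g \<longleftrightarrow>
     1 \<le> j \<and> j < n \<and> 1 \<le> l \<and>
     1 \<le> m 1 \<and> (\<forall>i. 1 \<le> i \<and> i < n \<longrightarrow> m i \<le> m (i + 1)) \<and>
     (\<forall>i. j < i \<and> i \<le> n \<longrightarrow> l < g i \<and> g i < m i) \<and>
     g (j + 1) < m j \<and>
     (\<forall>i. j < i \<and> i < n \<longrightarrow> g i \<le> g (i + 1) \<and> g (i + 1) < m i)"

definition gated_ferrers_cells ::
    "nat \<Rightarrow> nat \<Rightarrow> int \<Rightarrow> (nat \<Rightarrow> int) \<Rightarrow> (nat \<Rightarrow> int) \<Rightarrow> cell set" where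
  "gated_ferrers_cells n j l m g =
     {(c, int i) | c i. 1 \<le> i \<and> i \<le> j \<and> 1 \<le> c \<and> c \<le> m i} \<union>
     {(c, int i) | c i. j < i \<and> i \<le> n \<and> (1 \<le> c \<and> c \<le> l \<or> g i + 1 \<le> c \<and> c \<le> m i)}"

text \<open>
  A diagram is its set of cells, so that values of \<open>m\<close> and \<open>g\<close> at irrelevant indices play no role
  in the enumeration.
\<close>

definition gated_ferrers :: "cell set \<Rightarrow> bool" where
  "gated_ferrers S \<longleftrightarrow>
     (\<exists>n j l m g. gated_ferrers_data n j l m g \<and> S = gated_ferrers_cells n j l m g)"

definition gated_ferrers_count :: "nat \<Rightarrow> nat" where
  "gated_ferrers_count p = card {S. gated_ferrers S \<and> half_perimeter S = real p}"

definition gated_ferrers_gf :: "int fps" where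
  "gated_ferrers_gf = Abs_fps (\<lambda>p. int (gated_ferrers_count p))"

end

theory Submission
  imports Defs
begin

text \<open>
  A gated row with gate end \<open>g\<close> and length \<open>m\<close> can carry a row with gate end \<open>g'\<close> and length
  \<open>m'\<close> iff \<open>g \<le> g' < m \<le> m'\<close>, and this adds \<open>m' - m + 2\<close> to the half-perimeter. Hence the generating
  function \<open>G d\<close> of the possible continuations depends only on \<open>d = m - g\<close> and satisfies
  \<open>t G (d + 2) - (1 + t - t^2) G (d + 1) + G d = 0\<close> with \<open>G 0 = 1\<close>. This recurrence has only one
  power series solution, namely \<open>G d = L^d\<close> with \<open>L = G 1\<close> and \<open>t L^2 - (1 + t - t^2) L + 1 = 0\<close>.
  The full rows below a row of length \<open>M\<close> contribute \<open>1 / (1 - t)^M\<close>. Summing the geometric series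
  over \<open>m\<^sub>j\<close> and \<open>l\<close>, first with arbitrary continuations and then with empty ones only, gives
  \<open>\<phi> = t^3 (1 / ((1 - 2 t) (1 - t - t L)) - 1 / (1 - 2 t)^2)\<close>, and eliminating \<open>L\<close> yields the
  equation.
\<close>

unbundle fps_syntax

subsection \<open>Generating functions of weighted sets\<close>

definition finite_levels :: "'a set \<Rightarrow> ('a \<Rightarrow> nat) \<Rightarrow> bool" where
  "finite_levels A w \<longleftrightarrow> (\<forall>p. finite {x \<in> A. w x = p})"

definition weight_gf :: "'a set \<Rightarrow> ('a \<Rightarrow> nat) \<Rightarrow> 'b :: semiring_1 fps" where
  "weight_gf A w = Abs_fps (\<lambda>p. of_nat (card {x \<in> A. w x = p}))"

lemma weight_gf_singleton: "weight_gf {x} w = fps_X ^ w x"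
proof (rule fps_ext)
  fix p
  have "{y \<in> {x}. w y = p} = (if p = w x then {x} else {})"
    by auto
  then show "weight_gf {x} w $ p = (fps_X ^ w x) $ p"
    by (simp add: weight_gf_def)
qed

lemma weight_gf_image:
  assumes inj: "inj_on f A" and weight: "\<And>x. x \<in> A \<Longrightarrow> v (f x) = k + w x"
  shows "weight_gf (f ` A) v = fps_X ^ k * weight_gf A w"
proof (rule fps_ext)
  fix p
  show "weight_gf (f ` A) v $ p = (fps_X ^ k * weight_gf A w) $ p"
  proof (cases "p < k")
    case True
    then have "{x \<in> f ` A. v x = p} = {}"
      using weight by auto
    with True show ?thesis
      by (simp only: weight_gf_def fps_nth_Abs_fps fps_X_power_mult_nth card.empty) simp
  next
    case False
    then have "{x \<in> f ` A. v x = p} = f ` {x \<in> A. w x = p - k}"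
      using weight by auto
    moreover have "inj_on f {x \<in> A. w x = p - k}"
      using inj by (rule inj_on_subset) auto
    ultimately have "card {x \<in> f ` A. v x = p} = card {x \<in> A. w x = p - k}"
      by (simp add: card_image)
    with False show ?thesis
      by (simp add: weight_gf_def fps_X_power_mult_nth)
  qed
qed

lemma weight_gf_image_eq_image:
  assumes eq_iff: "\<And>x y. x \<in> D \<Longrightarrow> y \<in> D \<Longrightarrow> f x = f y \<longleftrightarrow> h x = h y"
    and weight: "\<And>x. x \<in> D \<Longrightarrow> v (f x) = k + w (h x)"
  shows "weight_gf (f ` D) v = fps_X ^ k * weight_gf (h ` D) w"
proof -
  define r where "r = f \<circ> inv_into D h"
  have r: "r (h x) = f x" if "x \<in> D" for x
    using that eq_iff[of "inv_into D h (h x)" x]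
    by (simp add: r_def inv_into_into f_inv_into_f)
  have "f ` D = r ` h ` D"
    using r by (auto simp: image_image)
  moreover have "inj_on r (h ` D)"
    using eq_iff r by (auto simp: inj_on_def)
  ultimately show ?thesis
    using weight r by (auto intro!: weight_gf_image)
qed

lemma weight_gf_Un_disjoint:
  assumes fin: "finite_levels C w" and C: "C = A \<union> B" and "A \<inter> B = {}"
  shows "weight_gf C w = weight_gf A w + weight_gf B w"
proof (rule fps_ext)
  fix p
  have "{x \<in> C. w x = p} = {x \<in> A. w x = p} \<union> {x \<in> B. w x = p}"
    using C by auto
  moreover have "finite {x \<in> C. w x = p}"
    using fin by (simp add: finite_levels_def)
  ultimately have "card {x \<in> C. w x = p} = card {x \<in> A. w x = p} + card {x \<in> B. w x = p}"
    using \<open>A \<inter> B = {}\<close> by (simp only: finite_Un, intro card_Un_disjoint) auto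
  then show "weight_gf C w $ p = (weight_gf A w + weight_gf B w) $ p"
    by (simp add: weight_gf_def)
qed

lemma weight_gf_Diff:
  fixes w :: "'a \<Rightarrow> nat"
  assumes "finite_levels A w" and "B \<subseteq> A"
  shows "(weight_gf (A - B) w :: 'b :: ring_1 fps) = weight_gf A w - weight_gf B w"
proof -
  have "(weight_gf A w :: 'b fps) = weight_gf (A - B) w + weight_gf B w"
    using assms by (intro weight_gf_Un_disjoint) auto
  then show ?thesis
    by simp
qed

lemma levels_Times:
  fixes v :: "'a \<Rightarrow> nat" and w :: "'b \<Rightarrow> nat"
  shows "{z \<in> A \<times> B. (case z of (x, y) \<Rightarrow> v x + w y) = p} =
     (\<Union>i\<in>{0..p}. {x \<in> A. v x = i} \<times> {y \<in> B. w y = p - i})"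
  by (auto split: prod.splits)

lemma finite_levels_Times:
  assumes "finite_levels A v" and "finite_levels B w"
  shows "finite_levels (A \<times> B) (\<lambda>(x, y). v x + w y)"
  using assms unfolding finite_levels_def levels_Times
  by (intro allI finite_UN_I finite_cartesian_product) simp_all

lemma weight_gf_Times:
  assumes "finite_levels A v" and "finite_levels B w"
  shows "weight_gf (A \<times> B) (\<lambda>(x, y). v x + w y) = weight_gf A v * weight_gf B w"
proof (rule fps_ext)
  fix p
  have "card {z \<in> A \<times> B. (case z of (x, y) \<Rightarrow> v x + w y) = p} =
      (\<Sum>i\<in>{0..p}. card ({x \<in> A. v x = i} \<times> {y \<in> B. w y = p - i}))"
    unfolding levels_Times
    using assms by (intro card_UN_disjoint) (auto simp: finite_levels_def)
  then show "weight_gf (A \<times> B) (\<lambda>(x, y). v x + w y) $ p = (weight_gf A v * weight_gf B w) $ p"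
    by (simp add: weight_gf_def fps_mult_nth card_cartesian_product)
qed

lemma finite_levels_Sigma:
  assumes "\<And>k. finite_levels (A k) (w k)"
  shows "finite_levels (Sigma UNIV A) (\<lambda>(k, x). k + w k x)"
  unfolding finite_levels_def
proof
  fix p
  have "{z \<in> Sigma UNIV A. (case z of (k, x) \<Rightarrow> k + w k x) = p} \<subseteq>
      (SIGMA k:{..p}. {x \<in> A k. w k x = p - k})"
    by auto
  moreover have "finite (SIGMA k:{..p}. {x \<in> A k. w k x = p - k})"
    using assms by (intro finite_SigmaI) (auto simp: finite_levels_def)
  ultimately show "finite {z \<in> Sigma UNIV A. (case z of (k, x) \<Rightarrow> k + w k x) = p}"
    by (rule finite_subset)
qed

lemma Sigma_nat_split: "Sigma UNIV A = Pair 0 ` A 0 \<union> map_prod Suc id ` (SIGMA k:UNIV. A (Suc k))"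
proof (intro equalityI subsetI)
  fix z assume "z \<in> Sigma UNIV A"
  then obtain k x where "z = (k, x)" "x \<in> A k"
    by auto
  then show "z \<in> Pair 0 ` A 0 \<union> map_prod Suc id ` (SIGMA k:UNIV. A (Suc k))"
    by (cases k) (auto intro!: image_eqI[of _ _ "(k - 1, x)"])
qed auto

lemma weight_gf_Sigma_Suc:
  assumes fin: "\<And>k. finite_levels (A k) (w k)"
  shows "weight_gf (Sigma UNIV A) (\<lambda>(k, x). k + w k x) =
    weight_gf (A 0) (w 0) +
    fps_X * weight_gf (SIGMA k:UNIV. A (Suc k)) (\<lambda>(k, x). k + w (Suc k) x)"
    (is "weight_gf _ ?v = _ + _ * weight_gf ?S ?v'")
proof -
  have "weight_gf (Sigma UNIV A) ?v =
      weight_gf (Pair 0 ` A 0) ?v + weight_gf (map_prod Suc id ` ?S) ?v"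
    by (rule weight_gf_Un_disjoint[OF finite_levels_Sigma Sigma_nat_split]) (use fin in auto)
  also have "weight_gf (Pair 0 ` A 0) ?v = fps_X ^ 0 * weight_gf (A 0) (w 0)"
    by (rule weight_gf_image) (auto simp: inj_on_def)
  also have "weight_gf (map_prod Suc id ` ?S) ?v = fps_X ^ 1 * weight_gf ?S ?v'"
    by (rule weight_gf_image) (auto simp: inj_on_def)
  finally show ?thesis
    by simp
qed

lemma fps_eq_0_of_shift:
  fixes D :: "nat \<Rightarrow> 'a :: semiring_1 fps"
  assumes shift: "\<And>k. D k = fps_X * D (Suc k)"
  shows "D k = 0"
proof (rule fps_ext)
  fix p
  show "D k $ p = 0 $ p"
    by (induction p arbitrary: k) (subst shift, simp)+
qed

text \<open>
  The sum \<open>a / (1 - t r / q)\<close> of a geometric series, with the denominators cleared.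
\<close>

lemma weight_gf_Sigma_geometric:
  fixes q r :: "'b :: comm_ring_1 fps"
  assumes fin: "\<And>k. finite_levels (A k) (w k)"
    and ratio: "\<And>k. q * weight_gf (A (Suc k)) (w (Suc k)) = r * weight_gf (A k) (w k)"
  shows "(q - fps_X * r) * weight_gf (Sigma UNIV A) (\<lambda>(k, x). k + w k x) =
    q * weight_gf (A 0) (w 0)"
proof -
  define a :: "nat \<Rightarrow> 'b fps" where "a e = weight_gf (A e) (w e)" for e
  define S :: "nat \<Rightarrow> 'b fps" where
    "S e = weight_gf (SIGMA k:UNIV. A (e + k)) (\<lambda>(k, x). k + w (e + k) x)" for e
  have S: "S e = a e + fps_X * S (Suc e)" for e
    using weight_gf_Sigma_Suc[of "\<lambda>k. A (e + k)" "\<lambda>k. w (e + k)"] fin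
    by (simp add: S_def a_def)
  have "(q - fps_X * r) * S e - q * a e =
      fps_X * ((q - fps_X * r) * S (Suc e) - q * a (Suc e))" for e
    unfolding ratio[of e, folded a_def] by (subst S) (simp add: algebra_simps)
  then have "(q - fps_X * r) * S 0 - q * a 0 = 0"
    by (rule fps_eq_0_of_shift)
  then show ?thesis
    by (simp add: S_def a_def)
qed

subsection \<open>Rows below the gate\<close>

definition lower_rows :: "int \<Rightarrow> int list set" where
  "lower_rows M = {ms. sorted ms \<and> set ms \<subseteq> {1..M}}"

lemma finite_levels_lower_rows: "finite_levels (lower_rows M) length"
  unfolding finite_levels_def
proof
  fix p
  have "{ms \<in> lower_rows M. length ms = p} \<subseteq> {ms. set ms \<subseteq> {1..M} \<and> length ms = p}"
    by (auto simp: lower_rows_def)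
  then show "finite {ms \<in> lower_rows M. length ms = p}"
    by (rule finite_subset) (simp add: finite_lists_length_eq)
qed

lemma lower_rows_split:
  assumes "0 \<le> M"
  shows "lower_rows (M + 1) = lower_rows M \<union> (\<lambda>ms. ms @ [M + 1]) ` lower_rows (M + 1)"
proof (intro equalityI subsetI)
  fix ms assume ms: "ms \<in> lower_rows (M + 1)"
  show "ms \<in> lower_rows M \<union> (\<lambda>ms. ms @ [M + 1]) ` lower_rows (M + 1)"
  proof (cases ms rule: rev_cases)
    case (snoc ms' x)
    then show ?thesis
      using ms by (cases "x = M + 1") (fastforce simp: lower_rows_def sorted_append)+
  qed (simp add: lower_rows_def)
qed (use assms in \<open>fastforce simp: lower_rows_def sorted_append\<close>)

definition lower_gf :: "nat \<Rightarrow> 'a :: semiring_1 fps" where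
  "lower_gf k = weight_gf (lower_rows (int k)) length"

lemma lower_gf_0: "lower_gf 0 = 1"
proof -
  have "lower_rows 0 = {[]}"
    by (auto simp: lower_rows_def)
  then show ?thesis
    by (simp add: lower_gf_def weight_gf_singleton)
qed

lemma lower_gf_Suc: "(1 - fps_X) * lower_gf (Suc k) = (lower_gf k :: 'a :: comm_ring_1 fps)"
proof -
  have Suc: "int (Suc k) = int k + 1"
    by simp
  let ?full = "(\<lambda>ms. ms @ [int k + 1]) ` lower_rows (int k + 1)"
  have "(weight_gf (lower_rows (int k + 1)) length :: 'a fps) =
      weight_gf (lower_rows (int k)) length + weight_gf ?full length"
    by (rule weight_gf_Un_disjoint[OF finite_levels_lower_rows lower_rows_split])
      (auto simp: lower_rows_def)
  also have "(weight_gf ?full length :: 'a fps) =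
      fps_X ^ 1 * weight_gf (lower_rows (int k + 1)) length"
    by (rule weight_gf_image) (auto simp: inj_on_def)
  finally show ?thesis
    unfolding lower_gf_def Suc left_diff_distrib mult_1_left diff_eq_eq power_one_right .
qed

subsection \<open>Gated rows\<close>

text \<open>A gated row is the pair of its gate end \<open>g\<^sub>i\<close> and its length \<open>m\<^sub>i\<close>.\<close>

fun gate_step :: "int \<times> int \<Rightarrow> int \<times> int \<Rightarrow> bool" where
  "gate_step (g, m) (g', m') \<longleftrightarrow> g \<le> g' \<and> g' < m \<and> m \<le> m'"

definition upper_rows :: "int \<Rightarrow> int \<Rightarrow> (int \<times> int) list set" where
  "upper_rows g m = {ps. successively gate_step ((g, m) # ps)}"

definition upper_weight :: "int \<Rightarrow> (int \<times> int) list \<Rightarrow> nat" where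
  "upper_weight m ps = nat (last (m # map snd ps) - m) + 2 * length ps"

lemma upper_rows_Nil: "[] \<in> upper_rows g m"
  by (simp add: upper_rows_def)

lemma upper_rows_Cons_iff:
  "(g', m') # ps \<in> upper_rows g m \<longleftrightarrow> gate_step (g, m) (g', m') \<and> ps \<in> upper_rows g' m'"
  by (simp add: upper_rows_def)

lemma upper_rows_sorted:
  assumes "ps \<in> upper_rows g m"
  shows "sorted (g # map fst ps)" and "sorted (m # map snd ps)"
    and "\<And>s. s \<in> set ps \<Longrightarrow> fst s < snd s"
proof -
  have "sorted (g # map fst ps) \<and> sorted (m # map snd ps) \<and> (\<forall>s\<in>set ps. fst s < snd s)"
    using assms by (induction ps arbitrary: g m) (fastforce simp: upper_rows_Cons_iff)+
  then show "sorted (g # map fst ps)" and "sorted (m # map snd ps)"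
    and "\<And>s. s \<in> set ps \<Longrightarrow> fst s < snd s"
    by auto
qed

lemma upper_weight_Cons:
  assumes "ps \<in> upper_rows g (m + int k)"
  shows "upper_weight m ((g, m + int k) # ps) = 2 + (k + upper_weight (m + int k) ps)"
proof -
  have "m + int k \<le> last ((m + int k) # map snd ps)"
    using upper_rows_sorted(2)[OF assms] by (cases ps rule: rev_cases) auto
  then show ?thesis
    by (simp add: upper_weight_def)
qed

lemma finite_levels_upper_rows: "finite_levels (upper_rows g m) (upper_weight m)"
  unfolding finite_levels_def
proof
  fix p
  have "{ps \<in> upper_rows g m. upper_weight m ps = p} \<subseteq>
      {ps. set ps \<subseteq> {g..m + int p} \<times> {m..m + int p} \<and> length ps \<le> p}"
  proof (intro subsetI CollectI conjI)
    fix ps s assume ps: "ps \<in> {ps \<in> upper_rows g m. upper_weight m ps = p}" and s: "s \<in> set ps"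
    then have sorted: "sorted (g # map fst ps)" "sorted (m # map snd ps)" "fst s < snd s"
      using upper_rows_sorted[of ps g m] by auto
    have "snd s \<le> last (m # map snd ps)"
      using sorted(2) s by (cases ps rule: rev_cases) (auto simp: sorted_append)
    then have "snd s \<le> m + int p"
      using ps by (auto simp: upper_weight_def)
    then show "s \<in> {g..m + int p} \<times> {m..m + int p}"
      using sorted s by (cases s) auto
  qed (auto simp: upper_weight_def)
  then show "finite {ps \<in> upper_rows g m. upper_weight m ps = p}"
    by (rule finite_subset) (simp add: finite_lists_length_le)
qed

lemma upper_rows_closed: "upper_rows m m = {[]}"
proof -
  have "ps = []" if "ps \<in> upper_rows m m" for ps
    using that by (cases ps) (auto simp: upper_rows_Cons_iff)
  then show ?thesis
    using upper_rows_Nil by auto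
qed

lemma upper_rows_split:
  assumes "g < m"
  shows "upper_rows g m = upper_rows (g + 1) m \<union>
    (\<lambda>(k, ps). (g, m + int k) # ps) ` (SIGMA k:UNIV. upper_rows g (m + int k))"
    (is "_ = _ \<union> ?new ` ?S")
proof (intro equalityI subsetI)
  fix ps assume ps: "ps \<in> upper_rows g m"
  consider (none) "ps = []" | (wider) g' m' ps' where "ps = (g', m') # ps'" "g < g'"
    | (equal) m' ps' where "ps = (g, m') # ps'"
    using ps by (cases ps) (force simp: upper_rows_Cons_iff)+
  then show "ps \<in> upper_rows (g + 1) m \<union> ?new ` ?S"
  proof cases
    case equal
    then have "(nat (m' - m), ps') \<in> ?S" "ps = ?new (nat (m' - m), ps')"
      using ps by (auto simp: upper_rows_Cons_iff)
    then show ?thesis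
      by blast
  qed (use ps in \<open>auto simp: upper_rows_Cons_iff upper_rows_Nil\<close>)
next
  fix ps assume "ps \<in> upper_rows (g + 1) m \<union> ?new ` ?S"
  then show "ps \<in> upper_rows g m"
    using assms by (cases ps) (auto simp: upper_rows_Cons_iff upper_rows_Nil)
qed

lemma weight_gf_upper_rows_split:
  assumes "g < m"
  shows "weight_gf (upper_rows g m) (upper_weight m) =
    weight_gf (upper_rows (g + 1) m) (upper_weight m) +
    fps_X ^ 2 * weight_gf (SIGMA k:UNIV. upper_rows g (m + int k))
      (\<lambda>(k, ps). k + upper_weight (m + int k) ps)"
    (is "_ = _ + _ * weight_gf ?S ?v")
proof -
  let ?new = "\<lambda>(k, ps). (g, m + int k) # ps"
  have "weight_gf (upper_rows g m) (upper_weight m) =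
      weight_gf (upper_rows (g + 1) m) (upper_weight m) + weight_gf (?new ` ?S) (upper_weight m)"
    by (rule weight_gf_Un_disjoint[OF finite_levels_upper_rows upper_rows_split[OF assms]])
      (auto simp: upper_rows_Cons_iff)
  also have "weight_gf (?new ` ?S) (upper_weight m) = fps_X ^ 2 * weight_gf ?S ?v"
    by (rule weight_gf_image) (auto simp: inj_on_def upper_weight_Cons)
  finally show ?thesis .
qed

definition upper_gf :: "int \<Rightarrow> nat \<Rightarrow> 'a :: semiring_1 fps" where
  "upper_gf g d = weight_gf (upper_rows g (g + int d)) (upper_weight (g + int d))"

lemma upper_gf_0: "upper_gf g 0 = 1"
  by (simp add: upper_gf_def upper_rows_closed weight_gf_singleton upper_weight_def)

definition gate_recurrence :: "(int \<Rightarrow> nat \<Rightarrow> 'a :: comm_ring_1 fps) \<Rightarrow> bool" where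
  "gate_recurrence F \<longleftrightarrow> (\<forall>g d. F g (Suc d) =
     F (g + 1) d + fps_X * (F g (Suc (Suc d)) - F (g + 1) (Suc d) + fps_X * F g (Suc d)))"

lemma gate_recurrence_upper_gf: "gate_recurrence (upper_gf :: _ \<Rightarrow> _ \<Rightarrow> 'a :: comm_ring_1 fps)"
  unfolding gate_recurrence_def
proof (intro allI)
  fix g d
  define S :: "int \<Rightarrow> 'a fps" where
    "S m = weight_gf (SIGMA k:UNIV. upper_rows g (m + int k))
      (\<lambda>(k, ps). k + upper_weight (m + int k) ps)" for m
  have S: "S (g + int d) = upper_gf g d + fps_X * S (g + int (Suc d))" for d
    using weight_gf_Sigma_Suc[of "\<lambda>k. upper_rows g (g + int d + int k)"
        "\<lambda>k. upper_weight (g + int d + int k)"] finite_levels_upper_rows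
    by (simp add: S_def upper_gf_def add_ac)
  have split: "upper_gf g (Suc d) = upper_gf (g + 1) d + fps_X ^ 2 * S (g + int (Suc d))" for d
    using weight_gf_upper_rows_split[of g "g + int (Suc d)"]
    by (simp add: S_def upper_gf_def add_ac)
  have "fps_X ^ 2 * S (g + int (Suc d)) =
      fps_X * (fps_X ^ 2 * S (g + int (Suc (Suc d))) + fps_X * upper_gf g (Suc d))"
    by (subst S) (simp add: algebra_simps power2_eq_square)
  then show "(upper_gf g (Suc d) :: 'a fps) = upper_gf (g + 1) d + fps_X *
      (upper_gf g (Suc (Suc d)) - upper_gf (g + 1) (Suc d) + fps_X * upper_gf g (Suc d))"
    by (simp only: split add_diff_cancel_left')
qed

lemma gate_recurrence_unique:
  assumes F: "gate_recurrence F" and G: "gate_recurrence G" and "\<And>g. F g 0 = G g 0"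
  shows "F g d = G g d"
proof -
  have "\<forall>g d. F g d $ p = G g d $ p" for p
  proof (induction p rule: less_induct)
    case (less p)
    have "F g d $ p = G g d $ p" for g d
    proof (induction d arbitrary: g)
      case (Suc d)
      show ?case
        by (subst F[unfolded gate_recurrence_def, rule_format],
            subst G[unfolded gate_recurrence_def, rule_format]) (auto simp: Suc less)
    qed (simp add: assms)
    then show ?case
      by blast
  qed
  then show ?thesis
    by (auto intro: fps_ext)
qed

lemma upper_gf_translate: "(upper_gf g d :: 'a :: comm_ring_1 fps) = upper_gf 0 d"
proof -
  have "gate_recurrence (\<lambda>g' d. upper_gf (g + g') d :: 'a fps)"
    using gate_recurrence_upper_gf[where ?'a = 'a] unfolding gate_recurrence_def
    by (simp only: add.assoc[symmetric]) blast
  then have "upper_gf (g + 0) d = (upper_gf 0 d :: 'a fps)"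
    by (rule gate_recurrence_unique[OF _ gate_recurrence_upper_gf]) (simp add: upper_gf_0)
  then show ?thesis
    by simp
qed

lemma upper_gf_rec:
  "(upper_gf 0 (Suc d) :: 'a :: comm_ring_1 fps) = upper_gf 0 d +
     fps_X * (upper_gf 0 (Suc (Suc d)) - upper_gf 0 (Suc d) + fps_X * upper_gf 0 (Suc d))"
  using gate_recurrence_upper_gf[where ?'a = 'a] unfolding gate_recurrence_def
  by (metis upper_gf_translate)

text \<open>
  The solutions of the recurrence form a module, and each is determined by its initial value. So
  the shifted solution is \<open>upper_gf 0 1\<close> times the original one.
\<close>

lemma upper_gf_eq_power: "(upper_gf g d :: 'a :: comm_ring_1 fps) = upper_gf 0 1 ^ d"
proof -
  define L :: "'a fps" where "L = upper_gf 0 1"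
  have shifted: "gate_recurrence (\<lambda>_ d. upper_gf 0 (Suc d) :: 'a fps)"
    unfolding gate_recurrence_def using upper_gf_rec by blast
  have scaled: "gate_recurrence (\<lambda>_ d. L * upper_gf 0 d)"
    unfolding gate_recurrence_def
  proof (intro allI)
    fix d
    show "L * upper_gf 0 (Suc d) = L * upper_gf 0 d +
        fps_X * (L * upper_gf 0 (Suc (Suc d)) - L * upper_gf 0 (Suc d) +
          fps_X * (L * upper_gf 0 (Suc d)))"
      by (subst upper_gf_rec) (simp add: algebra_simps)
  qed
  have step: "upper_gf 0 (Suc d) = L * upper_gf 0 d" for d
    by (rule gate_recurrence_unique[OF shifted scaled]) (simp add: L_def upper_gf_0)
  have "upper_gf 0 d = L ^ d"
    by (induction d) (simp_all add: upper_gf_0 step)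
  then show ?thesis
    by (simp add: L_def upper_gf_translate[of g])
qed

lemma upper_gf_quadratic:
  fixes L :: "'a :: comm_ring_1 fps"
  defines "L \<equiv> upper_gf 0 1"
  shows "fps_X * L ^ 2 - (1 + fps_X - fps_X ^ 2) * L + 1 = 0"
proof -
  have "L = 1 + fps_X * (L ^ 2 - L + fps_X * L)"
    using upper_gf_rec[of 0, where ?'a = 'a] upper_gf_eq_power[of 0 "Suc (Suc 0)", where ?'a = 'a]
    by (simp add: L_def upper_gf_0 numeral_2_eq_2)
  then have "1 + fps_X * (L ^ 2 - L + fps_X * L) - L = 0"
    by (simp only: right_minus_eq)
  then show ?thesis
    by (simp add: algebra_simps power2_eq_square)
qed

subsection \<open>Codes of diagrams\<close>

text \<open>
  \<open>(e, d, ms, ps)\<close> encodes \<open>l = e + 1\<close>, the length \<open>m\<^sub>j = l + 1 + d\<close> of the topmost full row, the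
  rows below it, and the rows above it. The gate below the first gated row is taken to end at
  \<open>l + 1 = e + 2\<close>, the least value allowed for \<open>g\<close>. Since a diagram has at least one gated row, the
  generating function is a difference of two geometric sums, in which the lists \<open>ps\<close> range over
  \<open>U = upper_rows\<close> and over \<open>U = (\<lambda>_ _. {[]})\<close>.
\<close>

type_synonym diagram_code = "nat \<times> nat \<times> int list \<times> (int \<times> int) list"

definition stacks_at :: "(int \<Rightarrow> int \<Rightarrow> (int \<times> int) list set) \<Rightarrow> nat \<Rightarrow>
    (nat \<times> int list \<times> (int \<times> int) list) set" where
  "stacks_at U e =
     (SIGMA d:UNIV. lower_rows (int (e + 2 + d)) \<times> U (int e + 2) (int e + 2 + int d))"

definition stack_weight_at :: "nat \<Rightarrow> nat \<times> int list \<times> (int \<times> int) list \<Rightarrow> nat" where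
  "stack_weight_at e = (\<lambda>(d, ms, ps). d + (length ms + upper_weight (int e + 2 + int d) ps))"

definition row_stacks :: "(int \<Rightarrow> int \<Rightarrow> (int \<times> int) list set) \<Rightarrow> diagram_code set" where
  "row_stacks U = (SIGMA e:UNIV. stacks_at U e)"

definition stack_weight :: "diagram_code \<Rightarrow> nat" where
  "stack_weight = (\<lambda>(e, z). e + stack_weight_at e z)"

definition gated_codes :: "diagram_code set" where
  "gated_codes = row_stacks (\<lambda>g m. upper_rows g m - {[]})"

lemma stack_weight_at_altdef:
  "stack_weight_at e =
     (\<lambda>(d, z). d + (case z of (ms, ps) \<Rightarrow> length ms + upper_weight (int e + 2 + int d) ps))"
  by (auto simp: stack_weight_at_def)

lemma finite_levels_stacks_at:
  assumes "\<And>g m. finite_levels (U g m) (upper_weight m)"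
  shows "finite_levels (stacks_at U e) (stack_weight_at e)"
  unfolding stacks_at_def stack_weight_at_altdef
  by (intro finite_levels_Sigma finite_levels_Times finite_levels_lower_rows assms)

lemma finite_levels_row_stacks:
  assumes "\<And>g m. finite_levels (U g m) (upper_weight m)"
  shows "finite_levels (row_stacks U) stack_weight"
  unfolding row_stacks_def stack_weight_def
  by (intro finite_levels_Sigma finite_levels_stacks_at assms)

lemma weight_gf_stacks_at:
  fixes H :: "'a :: comm_ring_1 fps"
  assumes fin: "\<And>g m. finite_levels (U g m) (upper_weight m)"
    and power: "\<And>g d. weight_gf (U g (g + int d)) (upper_weight (g + int d)) = H ^ d"
  shows "(1 - fps_X - fps_X * H) * weight_gf (stacks_at U e) (stack_weight_at e) =
    (1 - fps_X) * lower_gf (e + 2)"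
proof -
  define A where
    "A = (\<lambda>d. lower_rows (int (e + 2 + d)) \<times> U (int e + 2) (int e + 2 + int d))"
  define w :: "nat \<Rightarrow> int list \<times> (int \<times> int) list \<Rightarrow> nat"
    where "w = (\<lambda>d (ms, ps). length ms + upper_weight (int e + 2 + int d) ps)"
  have fin_A: "finite_levels (A d) (w d)" for d
    unfolding A_def w_def by (intro finite_levels_Times finite_levels_lower_rows fin)
  have gf_A: "weight_gf (A d) (w d) = lower_gf (e + 2 + d) * H ^ d" for d
    unfolding A_def w_def weight_gf_Times[OF finite_levels_lower_rows fin] power lower_gf_def ..
  have "(1 - fps_X) * weight_gf (A (Suc d)) (w (Suc d)) = H * weight_gf (A d) (w d)" for d
  proof -
    have "(1 - fps_X) * (lower_gf (Suc (e + 2 + d)) * H ^ Suc d) =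
        H * (lower_gf (e + 2 + d) * H ^ d)"
      unfolding lower_gf_Suc[of "e + 2 + d", symmetric] by (simp only: power_Suc ac_simps)
    then show ?thesis
      by (simp add: gf_A)
  qed
  from weight_gf_Sigma_geometric[of A w, OF fin_A this]
  have "(1 - fps_X - fps_X * H) * weight_gf (Sigma UNIV A) (\<lambda>(d, z). d + w d z) =
      (1 - fps_X) * lower_gf (e + 2)"
    by (simp add: gf_A)
  then show ?thesis
    by (simp only: stacks_at_def stack_weight_at_altdef A_def w_def)
qed

lemma one_minus_fps_X_minus_fps_X_mult_neq_0:
  "1 - fps_X - fps_X * H \<noteq> (0 :: 'a :: ring_1 fps)"
proof -
  have "(1 - fps_X - fps_X * H) $ 0 = 1"
    by simp
  then show ?thesis
    by (metis fps_zero_nth zero_neq_one)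
qed

lemma weight_gf_row_stacks:
  fixes H :: "'a :: idom fps"
  assumes fin: "\<And>g m. finite_levels (U g m) (upper_weight m)"
    and power: "\<And>g d. weight_gf (U g (g + int d)) (upper_weight (g + int d)) = H ^ d"
  shows "(1 - 2 * fps_X) * (1 - fps_X - fps_X * H) * weight_gf (row_stacks U) stack_weight = 1"
proof -
  define S :: "nat \<Rightarrow> 'a fps" where "S e = weight_gf (stacks_at U e) (stack_weight_at e)" for e
  let ?C = "1 - fps_X - fps_X * H"
  have S: "?C * S e = (1 - fps_X) * lower_gf (e + 2)" for e
    unfolding S_def using fin power by (rule weight_gf_stacks_at)
  have "?C * ((1 - fps_X) * S (Suc e)) = ?C * S e" for e
    using S[of e] S[of "Suc e"] lower_gf_Suc[of "e + 2", where ?'a = 'a]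
    by (simp add: mult.left_commute)
  then have "(1 - fps_X) * S (Suc e) = 1 * S e" for e
    by (metis mult_left_cancel mult_1_left one_minus_fps_X_minus_fps_X_mult_neq_0)
  from weight_gf_Sigma_geometric[of "stacks_at U" stack_weight_at,
      OF finite_levels_stacks_at[OF fin] this[unfolded S_def]]
  have "(1 - fps_X - fps_X) * weight_gf (row_stacks U) stack_weight = (1 - fps_X) * S 0"
    by (simp add: row_stacks_def stack_weight_def S_def)
  then have "(1 - 2 * fps_X) * ?C * weight_gf (row_stacks U) stack_weight =
      (1 - fps_X) * (?C * S 0)"
    by algebra
  also have "\<dots> = 1"
    using lower_gf_Suc[of 0, where ?'a = 'a] lower_gf_Suc[of 1, where ?'a = 'a]
    by (simp add: S lower_gf_0 numeral_2_eq_2)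
  finally show ?thesis .
qed

lemma weight_gf_gated_codes:
  fixes L :: "'a :: idom fps"
  defines "L \<equiv> upper_gf 0 1"
  shows "(1 - 2 * fps_X) ^ 2 * (1 - fps_X - fps_X * L) * weight_gf gated_codes stack_weight =
    fps_X * (L - 1)"
proof -
  define T :: "(int \<Rightarrow> int \<Rightarrow> (int \<times> int) list set) \<Rightarrow> 'a fps"
    where "T U = weight_gf (row_stacks U) stack_weight" for U
  have codes: "gated_codes = row_stacks upper_rows - row_stacks (\<lambda>_ _. {[]})"
    by (auto simp: gated_codes_def row_stacks_def stacks_at_def)
  have "row_stacks (\<lambda>_ _. {[]}) \<subseteq> row_stacks upper_rows"
    using upper_rows_Nil by (auto simp: row_stacks_def stacks_at_def)
  then have "weight_gf gated_codes stack_weight = T upper_rows - T (\<lambda>_ _. {[]})"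
    unfolding T_def codes
    by (intro weight_gf_Diff finite_levels_row_stacks finite_levels_upper_rows)
  moreover have "(1 - 2 * fps_X) * (1 - fps_X - fps_X * L) * T upper_rows = 1"
    unfolding T_def
  proof (rule weight_gf_row_stacks)
    show "weight_gf (upper_rows g (g + int d)) (upper_weight (g + int d)) = L ^ d" for g d
      unfolding L_def upper_gf_def[symmetric] by (rule upper_gf_eq_power)
  qed (rule finite_levels_upper_rows)
  moreover have "(1 - 2 * fps_X) * (1 - fps_X - fps_X * 1) * T (\<lambda>_ _. {[]}) = 1"
    unfolding T_def
    by (rule weight_gf_row_stacks)
      (simp_all add: finite_levels_def weight_gf_singleton upper_weight_def)
  ultimately show ?thesis
    by algebra
qed

text \<open>
  Multiplied by \<open>(1 - t - t L)\<^sup>2\<close>, the claim is a multiple of the equation for \<open>L\<close>.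
\<close>

lemma gated_quadratic_elimination:
  fixes t L \<phi> :: "'a :: idom"
  assumes L: "t * L ^ 2 - (1 + t - t ^ 2) * L + 1 = 0"
    and \<phi>: "(1 - 2 * t) ^ 2 * (1 - t - t * L) * \<phi> = t ^ 4 * (L - 1)"
    and nonzero: "1 - t - t * L \<noteq> 0"
  shows "(t^2 * (1 - 2 * t)^4 * (1 - 3 * t + t^2)) * \<phi>^2
         + (t^4 * (1 - 3 * t + t^2) * (1 - 2 * t)^2) * \<phi> - t^10 = 0" (is "?lhs = 0")
proof -
  define A where "A = 1 - 3 * t + t ^ 2"
  define B where "B = 1 - 2 * t"
  define C where "C = 1 - t - t * L"
  have "C ^ 2 * ?lhs =
      t ^ 2 * A * (B ^ 2 * C * \<phi>) ^ 2 + t ^ 4 * A * C * (B ^ 2 * C * \<phi>) - t ^ 10 * C ^ 2"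
    unfolding A_def[symmetric] B_def[symmetric] by algebra
  also have "\<dots> = t ^ 8 * (t ^ 2 * A * (L - 1) ^ 2 + A * C * (L - 1) - t ^ 2 * C ^ 2)"
    unfolding \<phi>[folded B_def C_def] by algebra
  also have "\<dots> = - (t ^ 8 * B ^ 2 * (t * L ^ 2 - (1 + t - t ^ 2) * L + 1))"
    unfolding A_def B_def C_def by algebra
  finally show ?thesis
    using L nonzero by (simp add: C_def)
qed

subsection \<open>The half-perimeter\<close>

definition exits :: "('a \<Rightarrow> 'a) \<Rightarrow> 'a set \<Rightarrow> 'a set" where
  "exits f S = {x \<in> S. f x \<notin> S}"

lemma card_exits_inverse:
  assumes fin: "finite S" and inv: "\<And>x. h (f x) = x" "\<And>x. f (h x) = x"
  shows "card (exits h S) = card (exits f S)"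
proof -
  have exits: "card (exits k S) = card S - card {x \<in> S. k x \<in> S}" for k
  proof -
    have "exits k S = S - {x \<in> S. k x \<in> S}"
      by (auto simp: exits_def)
    then show ?thesis
      using fin by (simp add: card_Diff_subset)
  qed
  have "bij_betw f {x \<in> S. f x \<in> S} {x \<in> S. h x \<in> S}"
    using inv by (intro bij_betw_byWitness[where f' = h]) auto
  then show ?thesis
    unfolding exits by (simp only: bij_betw_same_card)
qed

abbreviation east :: "cell \<Rightarrow> cell" where "east \<equiv> \<lambda>(c, r). (c + 1, r)"
abbreviation west :: "cell \<Rightarrow> cell" where "west \<equiv> \<lambda>(c, r). (c - 1, r)"
abbreviation north :: "cell \<Rightarrow> cell" where "north \<equiv> \<lambda>(c, r). (c, r + 1)"
abbreviation south :: "cell \<Rightarrow> cell" where "south \<equiv> \<lambda>(c, r). (c, r - 1)"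

lemma card_boundary_edges:
  assumes fin: "finite S"
  shows "card (boundary_edges S) =
    card (exits east S) + card (exits west S) + card (exits north S) + card (exits south S)"
proof -
  define edges where "edges f = (\<lambda>x. (x, f x)) ` exits f S" for f :: "cell \<Rightarrow> cell"
  have card_edges: "card (edges f) = card (exits f S)" for f
    unfolding edges_def by (rule card_image) (auto simp: inj_on_def)
  have fin_edges: "finite (edges f)" for f
    using fin by (simp add: edges_def exits_def)
  have disjoint: "edges f \<inter> edges h = {}" if "\<And>x. f x \<noteq> h x" for f h
    using that unfolding edges_def by blast
  have "boundary_edges S = edges east \<union> edges west \<union> edges north \<union> edges south"
    by (auto simp: boundary_edges_def neighbours_def edges_def exits_def image_iff)
  then show ?thesis
    unfolding card_edges[symmetric]
    by (simp add: card_Un_disjoint fin_edges Int_Un_distrib2 disjoint split: prod.splits)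
qed

lemma half_perimeter_eq_exits:
  assumes "finite S"
  shows "half_perimeter S = real (card (exits east S) + card (exits north S))"
proof -
  have "card (exits west S) = card (exits east S)" "card (exits south S) = card (exits north S)"
    using assms by (auto intro!: card_exits_inverse)
  then show ?thesis
    by (simp add: half_perimeter_def card_boundary_edges[OF assms])
qed

lemma card_exits_north:
  assumes fin: "finite S"
    and convex: "\<And>c a b r. (c, a) \<in> S \<Longrightarrow> (c, b) \<in> S \<Longrightarrow> a \<le> r \<Longrightarrow> r \<le> b \<Longrightarrow> (c, r) \<in> S"
  shows "card (exits north S) = card (fst ` S)"
proof -
  have "inj_on fst (exits north S)"
  proof (rule inj_onI)
    fix x y
    assume "x \<in> exits north S" "y \<in> exits north S" "fst x = fst y"
    then obtain c a b where xy: "x = (c, a)" "y = (c, b)"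
      and "(c, a) \<in> S" "(c, b) \<in> S" "(c, a + 1) \<notin> S" "(c, b + 1) \<notin> S"
      by (cases x, cases y) (auto simp: exits_def)
    then have "\<not> a < b" "\<not> b < a"
      using convex[of c a b "a + 1"] convex[of c b a "b + 1"] by auto
    then show "x = y"
      by (simp add: xy)
  qed
  moreover have "fst ` exits north S = fst ` S"
  proof (intro equalityI subsetI)
    fix c assume "c \<in> fst ` S"
    define rows where "rows = {r. (c, r) \<in> S}"
    have fin_rows: "finite rows"
    proof (rule finite_subset)
      show "rows \<subseteq> snd ` S"
        by (force simp: rows_def)
    qed (use fin in simp)
    have "rows \<noteq> {}"
      using \<open>c \<in> fst ` S\<close> by (force simp: rows_def)
    then have "Max rows \<in> rows"
      using fin_rows by (intro Max_in)
    moreover have "Max rows + 1 \<notin> rows"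
      using Max_ge[OF fin_rows, of "Max rows + 1"] by auto
    ultimately show "c \<in> fst ` exits north S"
      by (auto simp: rows_def exits_def intro!: image_eqI[of _ _ "(c, Max rows)"])
  qed (auto simp: exits_def)
  ultimately show ?thesis
    by (metis card_image)
qed

subsection \<open>The cells of a diagram\<close>

locale gated_diagram =
  fixes n j :: nat and l :: int and m g :: "nat \<Rightarrow> int"
  assumes data: "gated_ferrers_data n j l m g"
begin

abbreviation "cells \<equiv> gated_ferrers_cells n j l m g"

lemma j_bounds: "1 \<le> j" "j < n" and l_pos: "1 \<le> l"
  using data by (auto simp: gated_ferrers_data_def)

lemma gate_bounds: "j < i \<Longrightarrow> i \<le> n \<Longrightarrow> l < g i" "j < i \<Longrightarrow> i \<le> n \<Longrightarrow> g i < m i"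
  using data by (auto simp: gated_ferrers_data_def)

lemma gate_less_below: "j \<le> i \<Longrightarrow> i < n \<Longrightarrow> g (Suc i) < m i"
  using data by (cases "i = j") (auto simp: gated_ferrers_data_def)

lemma l_less_row: "l + 1 < m j"
  using gate_less_below[of j] gate_bounds(1)[of "Suc j"] j_bounds by simp

lemma row_mono: "1 \<le> i \<Longrightarrow> i \<le> k \<Longrightarrow> k \<le> n \<Longrightarrow> m i \<le> m k"
  using data by - (rule lift_Suc_mono_le_ivl[of "{1..<n}"], auto simp: gated_ferrers_data_def)

lemma gate_mono: "j < i \<Longrightarrow> i \<le> k \<Longrightarrow> k \<le> n \<Longrightarrow> g i \<le> g k"
  using data by - (rule lift_Suc_mono_le_ivl[of "{j<..<n}"], auto simp: gated_ferrers_data_def)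

lemma row_pos: "1 \<le> i \<Longrightarrow> i \<le> n \<Longrightarrow> 1 \<le> m i"
  using row_mono[of 1 i] data by (auto simp: gated_ferrers_data_def)

lemma mem_cells:
  "(c, int i) \<in> cells \<longleftrightarrow> 1 \<le> i \<and> i \<le> n \<and> 1 \<le> c \<and> c \<le> m i \<and> (j < i \<longrightarrow> c \<le> l \<or> g i < c)"
proof (cases "j < i \<and> i \<le> n")
  case True
  then show ?thesis
    using gate_bounds[of i] l_pos by (auto simp: gated_ferrers_cells_def)
next
  case False
  then show ?thesis
    using j_bounds by (auto simp: gated_ferrers_cells_def)
qed

lemma cellE:
  assumes "x \<in> cells"
  obtains c i where "x = (c, int i)" "1 \<le> i" "i \<le> n"
  using assms j_bounds by (auto simp: gated_ferrers_cells_def)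

lemma finite_cells: "finite cells"
proof (rule finite_subset)
  show "cells \<subseteq> {1..m n} \<times> int ` {1..n}"
  proof
    fix x assume x: "x \<in> cells"
    then obtain c i where "x = (c, int i)" "1 \<le> i" "i \<le> n"
      by (rule cellE)
    then show "x \<in> {1..m n} \<times> int ` {1..n}"
      using x row_mono[of i n] by (auto simp: mem_cells)
  qed
qed simp

lemma column_convex:
  assumes "(c, a) \<in> cells" "(c, b) \<in> cells" "a \<le> r" "r \<le> b"
  shows "(c, r) \<in> cells"
proof -
  obtain a' b' where ab: "a = int a'" "b = int b'"
    using assms(1,2) by (metis cellE prod.inject)
  moreover obtain r' where r: "r = int r'"
    using ab assms(3) by (metis nonneg_int_cases of_nat_0_le_iff order_trans)
  ultimately show ?thesis
    using assms row_mono[of a' r'] gate_mono[of r' b'] unfolding ab r mem_cells by auto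
qed

lemma column_nonempty: "j \<le> k \<Longrightarrow> k \<le> n \<Longrightarrow> l < c \<Longrightarrow> c \<le> m k \<Longrightarrow> \<exists>i. (c, int i) \<in> cells"
proof (induction k rule: dec_induct)
  case base
  then have "(c, int j) \<in> cells"
    using j_bounds l_pos by (auto simp: mem_cells)
  then show ?case ..
next
  case (step k)
  show ?case
  proof (cases "g (Suc k) < c")
    case True
    with step have "(c, int (Suc k)) \<in> cells"
      using l_pos unfolding mem_cells by auto
    then show ?thesis ..
  next
    case False
    with step show ?thesis
      using gate_less_below[of k] by auto
  qed
qed

lemma columns: "fst ` cells = {1..m n}"
proof (intro equalityI subsetI)
  fix c assume "c \<in> fst ` cells"
  then obtain r where "(c, r) \<in> cells"
    by auto
  then obtain i where "(c, int i) \<in> cells"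
    by (auto elim: cellE)
  then show "c \<in> {1..m n}"
    using row_mono[of i n] by (auto simp: mem_cells)
next
  fix c assume c: "c \<in> {1..m n}"
  obtain i where "(c, int i) \<in> cells"
  proof (cases "c \<le> l")
    case True
    with c show ?thesis
      using j_bounds by (intro that[of n]) (auto simp: mem_cells)
  next
    case False
    with c show ?thesis
      using column_nonempty[of n c] j_bounds that by auto
  qed
  then show "c \<in> fst ` cells"
    by force
qed

lemma exits_east_cells:
  "exits east cells = (\<lambda>i. (m i, int i)) ` {1..n} \<union> (\<lambda>i. (l, int i)) ` {j<..n}" (is "?L = ?R")
proof (intro equalityI subsetI)
  fix x assume x: "x \<in> ?L"
  then obtain c i where x_eq: "x = (c, int i)" "1 \<le> i" "i \<le> n"
    by (auto simp: exits_def elim: cellE)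
  with x have "c = m i \<or> j < i \<and> c = l"
    by (auto simp: exits_def mem_cells)
  with x_eq show "x \<in> ?R"
    by auto
next
  fix x assume "x \<in> ?R"
  then consider (row_end) i where "x = (m i, int i)" "i \<in> {1..n}"
    | (gate_start) i where "x = (l, int i)" "i \<in> {j<..n}"
    by auto
  then show "x \<in> ?L"
  proof cases
    case (row_end i)
    then show ?thesis
      using gate_bounds[of i] row_pos[of i] by (auto simp: exits_def mem_cells)
  next
    case (gate_start i)
    then show ?thesis
      using gate_bounds[of i] l_pos by (auto simp: exits_def mem_cells)
  qed
qed

lemma half_perimeter_cells: "half_perimeter cells = real_of_int (m n) + real n + real (n - j)"
proof -
  have "card (exits east cells) = n + (n - j)"
    unfolding exits_east_cells
    by (subst card_Un_disjoint) (use gate_bounds in \<open>force simp: card_image inj_on_def\<close>)+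
  moreover have "card (exits north cells) = nat (m n)"
    using card_exits_north[OF finite_cells column_convex] by (simp add: columns)
  moreover have "0 \<le> m n"
    using row_pos[of n] j_bounds by simp
  ultimately show ?thesis
    by (simp add: half_perimeter_eq_exits[OF finite_cells])
qed

end

lemma gated_ferrers_cells_cong:
  assumes "j \<le> n" "\<And>i. 1 \<le> i \<Longrightarrow> i \<le> n \<Longrightarrow> m i = m' i" "\<And>i. j < i \<Longrightarrow> i \<le> n \<Longrightarrow> g i = g' i"
  shows "gated_ferrers_cells n j l m g = gated_ferrers_cells n j l m' g'"
  using assms unfolding gated_ferrers_cells_def
  by (intro arg_cong2[of _ _ _ _ "(\<union>)"] Collect_cong ex_cong1) auto

lemma gated_ferrers_cells_inject:
  assumes "gated_ferrers_data n j l m g" "gated_ferrers_data n' j' l' m' g'"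
    and eq: "gated_ferrers_cells n j l m g = gated_ferrers_cells n' j' l' m' g'"
  shows "n = n'" "j = j'" "l = l'"
    and "\<And>i. 1 \<le> i \<Longrightarrow> i \<le> n \<Longrightarrow> m i = m' i"
    and "\<And>i. j < i \<Longrightarrow> i \<le> n \<Longrightarrow> g i = g' i"
proof -
  interpret a: gated_diagram n j l m g
    using assms(1) by (rule gated_diagram.intro)
  interpret b: gated_diagram n' j' l' m' g'
    using assms(2) by (rule gated_diagram.intro)
  have mem: "1 \<le> i \<and> i \<le> n \<and> 1 \<le> c \<and> c \<le> m i \<and> (j < i \<longrightarrow> c \<le> l \<or> g i < c) \<longleftrightarrow>
      1 \<le> i \<and> i \<le> n' \<and> 1 \<le> c \<and> c \<le> m' i \<and> (j' < i \<longrightarrow> c \<le> l' \<or> g' i < c)" for c i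
    using a.mem_cells[of c i] b.mem_cells[of c i] by (simp only: eq)
  have "i \<le> n \<longleftrightarrow> i \<le> n'" if "1 \<le> i" for i
    using mem[of i 1] a.row_pos[OF that] b.row_pos[OF that] a.l_pos b.l_pos that by auto
  then show n: "n = n'"
    using a.j_bounds b.j_bounds by (meson dual_order.antisym le_refl le_trans less_imp_le)
  show m: "m i = m' i" if i: "1 \<le> i" "i \<le> n" for i
    using mem[of i "m i"] mem[of i "m' i"] a.row_pos[OF i] b.row_pos[of i]
      a.gate_bounds[of i] b.gate_bounds[of i] i n by auto
  have gated_iff: "j < i \<longleftrightarrow> j' < i" if i: "1 \<le> i" "i \<le> n" for i
    using mem[of i "l + 1"] mem[of i "l' + 1"] a.gate_bounds[of i] b.gate_bounds[of i]
      a.l_pos b.l_pos m[OF i] i n by auto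
  show j: "j = j'"
    using gated_iff[of "Suc j"] gated_iff[of "Suc j'"] a.j_bounds b.j_bounds n by auto
  show "l = l'"
    using mem[of n "l + 1"] mem[of n "l' + 1"] mem[of n l] mem[of n l']
      a.gate_bounds[of n] b.gate_bounds[of n] a.l_pos b.l_pos a.j_bounds j n m[of n] by auto
  show "g i = g' i" if i: "j < i" "i \<le> n" for i
    using mem[of i "g i"] mem[of i "g' i"] a.gate_bounds[OF i] b.gate_bounds[of i]
      a.l_pos b.l_pos a.j_bounds j n m[of i] i by auto
qed

subsection \<open>Encoding diagrams\<close>

definition data_code :: "nat \<Rightarrow> nat \<Rightarrow> int \<Rightarrow> (nat \<Rightarrow> int) \<Rightarrow> (nat \<Rightarrow> int) \<Rightarrow> diagram_code" where
  "data_code n j l m g =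
     (nat (l - 1), nat (m j - l - 1), map m [1..<j], map (\<lambda>i. (g i, m i)) [Suc j..<Suc n])"

lemma (in gated_diagram) half_perimeter_eq_stack_weight:
  "half_perimeter cells = real (3 + stack_weight (data_code n j l m g))"
proof -
  have "last (m j # map m [Suc j..<Suc n]) = m n"
    using j_bounds by simp
  then have "int (upper_weight (m j) (map (\<lambda>i. (g i, m i)) [Suc j..<Suc n])) =
      m n - m j + 2 * int (n - j)"
    using row_mono[of j n] j_bounds by (simp add: upper_weight_def comp_def del: upt_Suc)
  then have "int (3 + stack_weight (data_code n j l m g)) = m n + int n + int (n - j)"
    using l_pos l_less_row j_bounds
    by (simp add: data_code_def stack_weight_def stack_weight_at_def del: upt_Suc)
  then show ?thesis
    using half_perimeter_cells by linarith
qed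

lemma data_code_inject:
  assumes "gated_ferrers_data n j l m g" and "gated_ferrers_data n' j' l' m' g'"
    and eq: "data_code n j l m g = data_code n' j' l' m' g'"
  shows "n = n'" "j = j'" "l = l'"
    and "\<And>i. 1 \<le> i \<Longrightarrow> i \<le> n \<Longrightarrow> m i = m' i"
    and "\<And>i. j < i \<Longrightarrow> i \<le> n \<Longrightarrow> g i = g' i"
proof -
  interpret a: gated_diagram n j l m g
    using assms(1) by (rule gated_diagram.intro)
  interpret b: gated_diagram n' j' l' m' g'
    using assms(2) by (rule gated_diagram.intro)
  have lower: "map m [1..<j] = map m' [1..<j']"
    and upper: "map (\<lambda>i. (g i, m i)) [Suc j..<Suc n] = map (\<lambda>i. (g' i, m' i)) [Suc j'..<Suc n']"
    using eq by (simp_all add: data_code_def del: upt_Suc)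
  show j: "j = j'"
    using arg_cong[OF lower, of length] a.j_bounds b.j_bounds by simp
  show n: "n = n'"
    using arg_cong[OF upper, of length] a.j_bounds b.j_bounds j by (simp del: upt_Suc)
  show l: "l = l'"
    using eq a.l_pos b.l_pos by (auto simp: data_code_def)
  have m_j: "m j = m' j"
    using eq a.l_less_row b.l_less_row by (auto simp: data_code_def l j)
  have upper_eq: "g i = g' i \<and> m i = m' i" if "j < i" "i \<le> n" for i
    using upper[folded j n] that by (auto simp del: upt_Suc)
  show "m i = m' i" if "1 \<le> i" "i \<le> n" for i
    using that lower[folded j] m_j upper_eq[of i] by (cases i j rule: linorder_cases) auto
  show "g i = g' i" if "j < i" "i \<le> n" for i
    using upper_eq[OF that] by simp
qed

lemma data_code_eq_iff_cells_eq:
  assumes "gated_ferrers_data n j l m g" and "gated_ferrers_data n' j' l' m' g'"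
  shows "data_code n j l m g = data_code n' j' l' m' g' \<longleftrightarrow>
    gated_ferrers_cells n j l m g = gated_ferrers_cells n' j' l' m' g'"
proof
  assume "data_code n j l m g = data_code n' j' l' m' g'"
  note inject = data_code_inject[OF assms this]
  have "j \<le> n"
    using assms(1) by (simp add: gated_ferrers_data_def)
  then show "gated_ferrers_cells n j l m g = gated_ferrers_cells n' j' l' m' g'"
    unfolding inject(1-3)[symmetric] using inject(4,5) by (rule gated_ferrers_cells_cong)
next
  assume "gated_ferrers_cells n j l m g = gated_ferrers_cells n' j' l' m' g'"
  note inject = gated_ferrers_cells_inject[OF assms this]
  moreover have "1 \<le> j" "j < n"
    using assms(1) by (auto simp: gated_ferrers_data_def)
  ultimately show "data_code n j l m g = data_code n' j' l' m' g'"
    by (auto simp: data_code_def simp del: upt_Suc)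
qed

lemma map_mem_lower_rows_iff:
  assumes "1 \<le> j" and "1 \<le> m j"
  shows "map m [1..<j] \<in> lower_rows (m j) \<longleftrightarrow>
    1 \<le> m 1 \<and> (\<forall>i. 1 \<le> i \<and> i < j \<longrightarrow> m i \<le> m (i + 1))"
proof
  assume rows: "map m [1..<j] \<in> lower_rows (m j)"
  have "1 \<le> m i \<and> m i \<le> m j" if "1 \<le> i" "i \<le> j" for i
    using rows that assms by (cases "i = j") (auto simp: lower_rows_def image_subset_iff)
  moreover have "m i \<le> m (i + 1)" if "1 \<le> i" "i + 1 < j" for i
  proof -
    have "map m [1..<j] ! (i - 1) \<le> map m [1..<j] ! i"
      using rows that by (intro sorted_nth_mono) (auto simp: lower_rows_def)
    with that show ?thesis
      by simp
  qed
  ultimately show "1 \<le> m 1 \<and> (\<forall>i. 1 \<le> i \<and> i < j \<longrightarrow> m i \<le> m (i + 1))"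
    using assms by (metis Suc_eq_plus1 Suc_lessI less_imp_le order_refl)
next
  assume rows: "1 \<le> m 1 \<and> (\<forall>i. 1 \<le> i \<and> i < j \<longrightarrow> m i \<le> m (i + 1))"
  have mono: "m i \<le> m k" if "1 \<le> i" "i \<le> k" "k \<le> j" for i k
    using that rows by - (rule lift_Suc_mono_le_ivl[of "{1..<j}"], auto)
  have "1 \<le> m i" if "1 \<le> i" "i \<le> j" for i
    using mono[of 1 i] rows that by simp
  then show "map m [1..<j] \<in> lower_rows (m j)"
    by (auto simp: lower_rows_def sorted_iff_nth_mono intro!: mono)
qed

lemma map_mem_upper_rows_iff:
  assumes "j \<le> n"
  shows "map (\<lambda>i. (g i, m i)) [Suc j..<Suc n] \<in> upper_rows h (m j) \<longleftrightarrow>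
    (\<forall>i. j \<le> i \<and> i < n \<longrightarrow> gate_step (if i = j then h else g i, m i) (g (i + 1), m (i + 1)))"
proof -
  define row where "row i = (if i = j then h else g i, m i)" for i
  have rows: "(h, m j) # map (\<lambda>i. (g i, m i)) [Suc j..<Suc n] = map row [j..<Suc n]"
    using assms by (auto simp: row_def upt_conv_Cons[of j "Suc n"] simp del: upt_Suc)
  have "map (\<lambda>i. (g i, m i)) [Suc j..<Suc n] \<in> upper_rows h (m j) \<longleftrightarrow>
      (\<forall>k. k < n - j \<longrightarrow> gate_step (row (j + k)) (row (j + k + 1)))"
    unfolding upper_rows_def mem_Collect_eq rows
    using assms by (simp add: successively_conv_nth Suc_diff_le del: upt_Suc)
  also have "\<dots> \<longleftrightarrow> (\<forall>i. j \<le> i \<and> i < n \<longrightarrow> gate_step (row i) (row (i + 1)))"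
  proof (intro iffI allI impI)
    fix i assume "\<forall>k. k < n - j \<longrightarrow> gate_step (row (j + k)) (row (j + k + 1))" "j \<le> i \<and> i < n"
    then show "gate_step (row i) (row (i + 1))"
      by (auto dest: spec[of _ "i - j"])
  qed auto
  finally show ?thesis
    by (simp add: row_def)
qed

lemma gated_ferrers_data_iff_gate_step:
  assumes "1 \<le> j" "j < n" "1 \<le> l"
  shows "gated_ferrers_data n j l m g \<longleftrightarrow>
    1 \<le> m 1 \<and> (\<forall>i. 1 \<le> i \<and> i < j \<longrightarrow> m i \<le> m (i + 1)) \<and>
    (\<forall>i. j \<le> i \<and> i < n \<longrightarrow>
      gate_step (if i = j then l + 1 else g i, m i) (g (i + 1), m (i + 1)))"
    (is "_ \<longleftrightarrow> _ \<and> ?lower \<and> (\<forall>i. _ \<longrightarrow> ?step i)")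
proof
  assume "gated_ferrers_data n j l m g"
  then show "1 \<le> m 1 \<and> ?lower \<and> (\<forall>i. j \<le> i \<and> i < n \<longrightarrow> ?step i)"
    by (auto simp: gated_ferrers_data_def)
next
  assume rows: "1 \<le> m 1 \<and> ?lower \<and> (\<forall>i. j \<le> i \<and> i < n \<longrightarrow> ?step i)"
  then have row_step: "?step i" if "j \<le> i" "i < n" for i
    using that by blast
  have "l < g i \<and> g i < m i" if "Suc j \<le> i" "i \<le> n" for i
    using that
  proof (induction i rule: dec_induct)
    case base
    then show ?case
      using row_step[of j] by simp
  next
    case (step i)
    then show ?case
      using row_step[of i] by simp
  qed
  moreover have "m i \<le> m (i + 1)" if "1 \<le> i" "i < n" for i
    using rows row_step[of i] that by (cases "i < j") auto
  moreover have "g (j + 1) < m j"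
    using row_step[of j] \<open>j < n\<close> by simp
  moreover have "g i \<le> g (i + 1) \<and> g (i + 1) < m i" if "j < i" "i < n" for i
    using row_step[of i] that by simp
  ultimately show "gated_ferrers_data n j l m g"
    using rows assms by (auto simp: gated_ferrers_data_def)
qed

lemma data_code_mem_gated_codes_iff:
  assumes "1 \<le> j" "j < n" "1 \<le> l" "l < m j"
  shows "data_code n j l m g \<in> gated_codes \<longleftrightarrow> gated_ferrers_data n j l m g"
proof -
  have "data_code n j l m g \<in> gated_codes \<longleftrightarrow>
      map m [1..<j] \<in> lower_rows (m j) \<and>
      map (\<lambda>i. (g i, m i)) [Suc j..<Suc n] \<in> upper_rows (l + 1) (m j)"
    using assms
    by (simp add: data_code_def gated_codes_def row_stacks_def stacks_at_def add.commute
        del: upt_Suc)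
  also have "\<dots> \<longleftrightarrow> gated_ferrers_data n j l m g"
    using assms map_mem_lower_rows_iff[of j m] map_mem_upper_rows_iff[of j n g m "l + 1"]
    by (simp only: gated_ferrers_data_iff_gate_step) auto
  finally show ?thesis .
qed

lemma gated_codesE:
  assumes "x \<in> gated_codes"
  obtains n j l m g where "gated_ferrers_data n j l m g" "x = data_code n j l m g"
proof -
  obtain e d ms ps where x: "x = (e, d, ms, ps)"
    by (cases x)
  define j where "j = Suc (length ms)"
  define n where "n = j + length ps"
  define l where "l = int e + 1"
  define m where "m i = (ms @ (int e + 2 + int d) # map snd ps) ! (i - 1)" for i
  define g where "g i = fst (ps ! (i - Suc j))" for i
  have m_j: "m j = int e + 2 + int d"
    by (simp add: m_def j_def)
  have "map m [1..<j] = ms"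
    by (rule nth_equalityI) (auto simp: m_def j_def nth_append simp del: upt_Suc)
  moreover have "map (\<lambda>i. (g i, m i)) [Suc j..<Suc n] = ps"
    by (rule nth_equalityI)
      (auto simp: m_def g_def j_def n_def nth_append nth_Cons' simp del: upt_Suc)
  ultimately have code: "data_code n j l m g = x"
    by (simp add: data_code_def x m_j l_def del: upt_Suc)
  have "ps \<noteq> []"
    using assms by (simp add: x gated_codes_def row_stacks_def stacks_at_def)
  then have "gated_ferrers_data n j l m g"
    using assms data_code_mem_gated_codes_iff[of j n l m g] m_j
    by (simp add: code) (simp add: j_def n_def l_def)
  with code show ?thesis
    using that by blast
qed

lemma gated_codes_eq_image:
  "gated_codes =
     (\<lambda>(n, j, l, m, g). data_code n j l m g) ` {(n, j, l, m, g). gated_ferrers_data n j l m g}"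
  (is "_ = ?code ` ?data")
proof (intro equalityI subsetI)
  fix x assume "x \<in> gated_codes"
  then show "x \<in> ?code ` ?data"
    by (rule gated_codesE) force
next
  fix x assume "x \<in> ?code ` ?data"
  then obtain n j l m g where data: "gated_ferrers_data n j l m g"
    and x: "x = data_code n j l m g"
    by auto
  interpret gated_diagram n j l m g
    using data by (rule gated_diagram.intro)
  show "x \<in> gated_codes"
    using data data_code_mem_gated_codes_iff[of j n l m g] j_bounds l_pos l_less_row
    by (simp add: x)
qed

lemma gated_ferrers_gf_eq: "gated_ferrers_gf = fps_X ^ 3 * weight_gf gated_codes stack_weight"
proof -
  define data where "data = {(n, j, l, m, g). gated_ferrers_data n j l m g}"
  define cells where "cells = (\<lambda>(n, j, l, m, g). gated_ferrers_cells n j l m g)"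
  define code where "code = (\<lambda>(n, j, l, m, g). data_code n j l m g)"
  define weight where "weight S = nat \<lfloor>half_perimeter S\<rfloor>" for S
  have half_perimeter: "half_perimeter (cells x) = real (3 + stack_weight (code x))"
    if "x \<in> data" for x
    using that gated_diagram.half_perimeter_eq_stack_weight[OF gated_diagram.intro]
    by (auto simp: data_def cells_def code_def simp del: of_nat_add)
  have "gated_ferrers S \<longleftrightarrow> S \<in> cells ` data" for S
    by (force simp: gated_ferrers_def cells_def data_def)
  then have "{S. gated_ferrers S \<and> half_perimeter S = real p} =
      {S \<in> cells ` data. weight S = p}" for p
    using half_perimeter by (auto simp: weight_def simp del: of_nat_add)
  then have "gated_ferrers_gf = weight_gf (cells ` data) weight"
    by (simp add: gated_ferrers_gf_def gated_ferrers_count_def weight_gf_def)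
  also have "\<dots> = fps_X ^ 3 * weight_gf (code ` data) stack_weight"
  proof (rule weight_gf_image_eq_image)
    show "cells x = cells y \<longleftrightarrow> code x = code y" if "x \<in> data" "y \<in> data" for x y
      using that data_code_eq_iff_cells_eq by (auto simp: data_def cells_def code_def)
    show "weight (cells x) = 3 + stack_weight (code x)" if "x \<in> data" for x
      using half_perimeter[OF that] by (simp add: weight_def)
  qed
  also have "code ` data = gated_codes"
    unfolding code_def data_def by (rule gated_codes_eq_image[symmetric])
  finally show ?thesis .
qed

theorem theorem1:
  fixes t \<phi> :: "int fps"
  defines "t \<equiv> fps_X" and "\<phi> \<equiv> gated_ferrers_gf"
  shows "(t^2 * (1 - 2 * t)^4 * (1 - 3 * t + t^2)) * \<phi>^2
         + (t^4 * (1 - 3 * t + t^2) * (1 - 2 * t)^2) * \<phi> - t^10 = 0"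
proof (rule gated_quadratic_elimination)
  define L :: "int fps" where "L = upper_gf 0 1"
  show "t * L ^ 2 - (1 + t - t ^ 2) * L + 1 = 0"
    unfolding t_def L_def by (rule upper_gf_quadratic)
  have "(1 - 2 * t) ^ 2 * (1 - t - t * L) * weight_gf gated_codes stack_weight = t * (L - 1)"
    unfolding t_def L_def by (rule weight_gf_gated_codes)
  then show "(1 - 2 * t) ^ 2 * (1 - t - t * L) * \<phi> = t ^ 4 * (L - 1)"
    unfolding \<phi>_def gated_ferrers_gf_eq t_def[symmetric] by algebra
  show "1 - t - t * L \<noteq> 0"
    unfolding t_def by (rule one_minus_fps_X_minus_fps_X_mult_neq_0)
qed

end
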